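(* Let $T>0$. Let $\sigma:\mathbb{R}\to\mathbb{R}$ be a function with $\sigma(x)\neq 0$ for all $x\in(0,\infty)$, $\sigma(x)=0$ for all $x\in(-\infty,0]$, and $\sigma^{-2}\in L^1_{loc}(0,\infty)$, i.e. $\int_a^b\sigma^{-2}(x)\,dx<\infty$ for every $[a,b]\subset(0,\infty)$. Let $g:[0,\infty)\to[0,\infty)$ satisfy $g(x)\le C(1+x)$ for all $x\ge 0$, for some constant $C>0$. If $$\int_1^\infty \frac{x}{\sigma^2(x)}\,dx=\infty,$$ then the Cauchy problem $$u_t+\tfrac12\sigma^2(x)\,u_{xx}=0 \text{ on } (0,\infty)\times[0,T),\qquad u(0,t)=g(0)\ \text{ for } t\le T,\qquad u(x,T)=g(x),$$ has a unique classical solution (if any), i.e. at most one classical solution, in the class of functions of at most linear growth.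
   Context: Points are written $(x,t)$ with $x\in[0,\infty)$, $t\in[0,T]$. A solution $u:[0,\infty)\times[0,T]\to\mathbb{R}$ of the Cauchy problem is said to be a classical solution if $u\in C^{2,1}((0,\infty)\times[0,T))$ (twice continuously differentiable in $x$ and once in $t$). A function $f:[0,\infty)\times[0,T]\to\mathbb{R}$ is of at most linear growth if there is a constant $C>0$ with $|f(x,t)|\le C(1+x)$ for all $(x,t)\in[0,\infty)\times[0,T]$.
   Formalization: A classical solution is additionally required to be jointly continuous on [0,∞)×[0,T], so the data are attained continuously; otherwise, for g = 0, both u = 0 and u(x,t) = x for t < T, u(x,T) = 0 are solutions of linear growth. *)

theory Defs
  imports "HOL-Analysis.Analysis"
begin

definition locally_L1_pos :: "(real \<Rightarrow> real) \<Rightarrow> bool" where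
  "locally_L1_pos f \<longleftrightarrow> (\<forall>a b. 0 < a \<and> a \<le> b \<longrightarrow> f absolutely_integrable_on {a..b})"

(* The time derivative is taken within [0,T): ordinary for 0 < t < T, right-sided at t = 0. *)
definition dt :: "real \<Rightarrow> (real \<Rightarrow> real \<Rightarrow> real) \<Rightarrow> real \<Rightarrow> real \<Rightarrow> real" where
  "dt T u x t = vector_derivative (\<lambda>s. u x s) (at t within {0..<T})"

definition dx :: "(real \<Rightarrow> real \<Rightarrow> real) \<Rightarrow> real \<Rightarrow> real \<Rightarrow> real" where
  "dx u x t = deriv (\<lambda>y. u y t) x"

definition dxx :: "(real \<Rightarrow> real \<Rightarrow> real) \<Rightarrow> real \<Rightarrow> real \<Rightarrow> real" where
  "dxx u = dx (dx u)"

(* u belongs to C^{2,1}((0,infinity) x [0,T)); continuity is joint in (x,t).  The explicit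
   differentiability clauses are needed because deriv and vector_derivative are total. *)
definition C21 :: "real \<Rightarrow> (real \<Rightarrow> real \<Rightarrow> real) \<Rightarrow> bool" where
  "C21 T u \<longleftrightarrow>
     (\<forall>x>0. \<forall>t\<in>{0..<T}.
        (\<lambda>y. u y t) differentiable (at x) \<and>
        (\<lambda>y. dx u y t) differentiable (at x) \<and>
        (\<lambda>s. u x s) differentiable (at t within {0..<T})) \<and>
     continuous_on ({0<..} \<times> {0..<T}) (\<lambda>(x, t). u x t) \<and>
     continuous_on ({0<..} \<times> {0..<T}) (\<lambda>(x, t). dx u x t) \<and>
     continuous_on ({0<..} \<times> {0..<T}) (\<lambda>(x, t). dxx u x t) \<and>
     continuous_on ({0<..} \<times> {0..<T}) (\<lambda>(x, t). dt T u x t)"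

definition linear_growth :: "real \<Rightarrow> (real \<Rightarrow> real \<Rightarrow> real) \<Rightarrow> bool" where
  "linear_growth T f \<longleftrightarrow>
     (\<exists>C>0. \<forall>x\<ge>0. \<forall>t\<in>{0..T}. \<bar>f x t\<bar> \<le> C * (1 + x))"

(* The continuity clause says that the boundary and terminal values are attained continuously.
   Without it nothing would link u on (0,infinity) x [0,T) to its data, and uniqueness would
   fail trivially: for g = 0 both u = 0 and u(x,t) = (if t < T then x else 0) would qualify. *)
definition classical_solution ::
  "real \<Rightarrow> (real \<Rightarrow> real) \<Rightarrow> (real \<Rightarrow> real) \<Rightarrow> (real \<Rightarrow> real \<Rightarrow> real) \<Rightarrow> bool" where
  "classical_solution T \<sigma> g u \<longleftrightarrow>
     C21 T u \<and>
     continuous_on ({0..} \<times> {0..T}) (\<lambda>(x, t). u x t) \<and>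
     (\<forall>x>0. \<forall>t\<in>{0..<T}. dt T u x t + 1/2 * (\<sigma> x)\<^sup>2 * dxx u x t = 0) \<and>
     (\<forall>t\<in>{0..T}. u 0 t = g 0) \<and>
     (\<forall>x\<ge>0. u x T = g x)"

end

theory Submission
  imports Defs
begin

text \<open>
  The difference w of two solutions has zero data and is compared with
  \<open>\<epsilon> * exp (T - t) * \<phi> x\<close>, where \<open>\<phi>'' x = 2 * (x - 1)\<^sup>+ / (\<sigma> x)\<^sup>2\<close> and \<open>\<phi> x \<ge> 1 + x\<close>; the divergence
  of the integral makes \<open>\<phi>\<close> superlinear, so a violation is maximal at an interior point \<open>(x0, t0)\<close>.
  As \<open>\<sigma>\<close> is merely measurable, \<open>\<phi>''\<close> need not exist at x0. But \<open>w x0 t0 > 0\<close> forces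
  \<open>w\<^sub>x\<^sub>x x0 s \<noteq> 0\<close> for some s (otherwise \<open>w\<^sub>t x0\<close> vanishes identically and w x0 keeps its final
  value 0), and then \<open>\<sigma>\<^sup>2 = - 2 * w\<^sub>t / w\<^sub>x\<^sub>x\<close> at time s shows that \<open>\<sigma>\<^sup>2\<close> is continuous at x0.
  Hence the classical maximum principle applies there.
\<close>

section \<open>Derivative tests at a maximum in one variable\<close>

lemma second_derivative_nonpos_at_local_max:
  fixes f f' :: "real \<Rightarrow> real"
  assumes "0 < d"
    and f': "\<And>y. \<bar>y - x\<bar> < d \<Longrightarrow> (f has_real_derivative f' y) (at y)"
    and f'': "(f' has_real_derivative D) (at x)"
    and max: "\<And>y. \<bar>y - x\<bar> < d \<Longrightarrow> f y \<le> f x"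
  shows "D \<le> 0"
proof (rule ccontr)
  assume "\<not> D \<le> 0"
  have "f' x = 0"
    using DERIV_local_max[of f "f' x" x d] f'[of x] max \<open>0 < d\<close> by (auto simp: abs_minus_commute)
  obtain e where e: "e > 0" "\<And>h. 0 < h \<Longrightarrow> h < e \<Longrightarrow> f' x < f' (x + h)"
    using DERIV_pos_inc_right[OF f''] \<open>\<not> D \<le> 0\<close> by auto
  \<comment> \<open>Half of the smaller radius keeps the interval from \<open>x\<close> to
    \<open>b\<close> inside both the region where \<open>f\<close> is differentiable and the region
    where \<open>f'\<close> is positive to the right of \<open>x\<close>. The mean value theorem
    then pushes \<open>f b\<close> above the maximum.\<close>
  define b where "b = x + min d e / 2"
  have b: "x < b" "b < x + d" "b < x + e" using e \<open>0 < d\<close> by (auto simp: b_def min_def)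
  obtain z where z: "x < z" "z < b" "f b - f x = (b - x) * f' z"
    using MVT2[of x b f f'] f' b by force
  have "0 < f' z" using e(2)[of "z - x"] z b \<open>f' x = 0\<close> by auto
  then have "f b > f x" using z b by (smt (verit) mult_pos_pos)
  then show False using max[of b] b by auto
qed

text \<open>A positive derivative would make \<open>f\<close> increase just to the right of
  \<open>t\<close>, and there is always room on the right because \<open>t < b\<close>. Arguing on
  that side alone covers \<open>t = a\<close>, so a maximum at the initial time needs no separate
  case.\<close>

lemma derivative_nonpos_at_right_max:
  fixes f :: "real \<Rightarrow> real"
  assumes "(f has_real_derivative D) (at t within {a..<b})" "t \<in> {a..<b}"
    and "\<And>s. s \<in> {a..<b} \<Longrightarrow> f s \<le> f t"
  shows "D \<le> 0"
proof (rule ccontr)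
  assume "\<not> D \<le> 0"
  then obtain d where d: "d > 0" "\<And>h. h > 0 \<Longrightarrow> t + h \<in> {a..<b} \<Longrightarrow> h < d \<Longrightarrow> f t < f (t + h)"
    using has_real_derivative_pos_inc_right[OF assms(1)] by auto
  define h where "h = min d (b - t) / 2"
  have "h > 0" "h < d" "t + h \<in> {a..<b}" using d assms(2) by (auto simp: h_def min_def field_simps)
  then show False using d(2)[of h] assms(3)[of "t + h"] by auto
qed

section \<open>Integration tools and the superlinear comparison function\<close>

lemma absolutely_integrable_continuous_mult:
  fixes f q :: "real \<Rightarrow> real"
  assumes "continuous_on {a..b} f" "q absolutely_integrable_on {a..b}"
  shows "(\<lambda>x. f x * q x) absolutely_integrable_on {a..b}"
proof (rule absolutely_integrable_bounded_measurable_product_real)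
  show "f \<in> borel_measurable (lebesgue_on {a..b})"
    using assms(1) by (intro continuous_imp_measurable_on_sets_lebesgue) auto
  show "bounded (f ` {a..b})"
    using assms(1) compact_continuous_image compact_imp_bounded by blast
qed (use assms in auto)

text \<open>Monotone convergence along the truncations to \<open>{a..a + real n}\<close>. It links
  bounds on gauge integrals over compact intervals to the extended Lebesgue integral in which the
  divergence hypothesis is expressed.\<close>

lemma nn_integral_atLeast_bounded:
  fixes f :: "real \<Rightarrow> real"
  assumes int: "\<And>b. a \<le> b \<Longrightarrow> f absolutely_integrable_on {a..b}"
    and nonneg: "\<And>x. a \<le> x \<Longrightarrow> 0 \<le> f x"
    and bound: "\<And>b. a \<le> b \<Longrightarrow> integral {a..b} f \<le> K"
  shows "(\<integral>\<^sup>+x\<in>{a..}. ennreal (f x) \<partial>lebesgue) < \<infinity>"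
proof -
  define F where "F n x = ennreal (indicator {a..a + real n} x * f x)" for n x
  have si: "integrable lebesgue (\<lambda>x. indicator {a..a + real n} x * f x)" for n
    using int[of "a + real n"] by (simp add: set_integrable_def)
  have "(\<integral>\<^sup>+x. F n x \<partial>lebesgue) \<le> ennreal K" for n
  proof -
    have "(\<integral>\<^sup>+x. F n x \<partial>lebesgue) = ennreal (\<integral>x. indicator {a..a + real n} x * f x \<partial>lebesgue)"
      unfolding F_def using nonneg by (intro nn_integral_eq_integral si) (auto simp: indicator_def)
    also have "(\<integral>x. indicator {a..a + real n} x * f x \<partial>lebesgue) = integral {a..a + real n} f"
      using set_lebesgue_integral_eq_integral(2)[OF int[of "a + real n"]]
      by (simp add: set_lebesgue_integral_def)
    finally show ?thesis using bound[of "a + real n"] by (simp add: ennreal_leI)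
  qed
  moreover have "(SUP n. F n x) = ennreal (f x) * indicator {a..} x" for x
  proof (cases "a \<le> x")
    case True
    obtain n where n: "x - a \<le> real n" using real_arch_simple by blast
    have "(SUP n. F n x) = ennreal (f x)"
    proof (rule antisym)
      show "(SUP n. F n x) \<le> ennreal (f x)"
        by (rule SUP_least) (use True nonneg in \<open>auto simp: F_def indicator_def\<close>)
      show "ennreal (f x) \<le> (SUP n. F n x)"
        by (rule SUP_upper2[of n]) (use True n in \<open>auto simp: F_def indicator_def\<close>)
    qed
    then show ?thesis using True by simp
  next
    case False
    then show ?thesis by (simp add: F_def)
  qed
  moreover have "(\<integral>\<^sup>+x. (SUP n. F n x) \<partial>lebesgue) = (SUP n. \<integral>\<^sup>+x. F n x \<partial>lebesgue)"
  proof (rule nn_integral_monotone_convergence_SUP)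
    show "incseq F"
      using nonneg by (auto simp: incseq_def le_fun_def F_def indicator_def)
    show "F n \<in> borel_measurable lebesgue" for n
      unfolding F_def using si by auto
  qed
  ultimately have "(\<integral>\<^sup>+x\<in>{a..}. ennreal (f x) \<partial>lebesgue) \<le> ennreal K"
    by (simp add: SUP_le_iff)
  then show ?thesis by (simp add: le_less_trans)
qed

text \<open>Here \<open>q\<close> is the inverse square of the diffusion coefficient, and
  \<open>\<phi>\<close> is obtained by integrating \<open>2 * max 0 (y - 1) * q y\<close> twice. The
  cut-off at 1 removes a possible singularity of \<open>q\<close> at 0, and it leaves enough mass at
  infinity for the divergence of the integral to make the slope \<open>P\<close> unbounded. Since
  \<open>q\<close> is only integrable, \<open>P\<close> is differentiated only where
  \<open>q\<close> is continuous.\<close>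

lemma superlinear_comparison_function:
  fixes q :: "real \<Rightarrow> real"
  assumes L1: "locally_L1_pos q"
    and q: "\<And>x. 0 \<le> q x"
    and inf: "(\<integral>\<^sup>+x\<in>{1..}. ennreal (x * q x) \<partial>lebesgue) = \<infinity>"
  obtains \<phi> P where "\<And>b. continuous_on {0..b} \<phi>" "\<And>x. 0 \<le> x \<Longrightarrow> 1 + x \<le> \<phi> x"
    "\<And>x. 0 < x \<Longrightarrow> (\<phi> has_real_derivative P x) (at x)"
    "\<And>x. 0 < x \<Longrightarrow> isCont q x \<Longrightarrow> (P has_real_derivative 2 * max 0 (x - 1) * q x) (at x)"
    "\<And>C r. \<exists>R>r. C * (1 + R) < \<phi> R"
proof -
  define \<psi> where "\<psi> y = 2 * max 0 (y - 1) * q y" for y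
  \<comment> \<open>The two added constants give \<open>P \<ge> 1\<close> and
    \<open>\<phi> 0 = 1\<close>, hence \<open>1 + x \<le> \<phi> x\<close>.\<close>
  define P where "P x = 1 + integral {0..x} \<psi>" for x
  define \<phi> where "\<phi> x = 1 + integral {0..x} P" for x
  have \<psi>_nonneg: "0 \<le> \<psi> y" for y using q by (simp add: \<psi>_def)
  have q_int: "q absolutely_integrable_on {1..b}" if "1 \<le> b" for b
    using L1 that by (auto simp: locally_L1_pos_def)
  have \<psi>_int1: "\<psi> absolutely_integrable_on {1..b}" if "1 \<le> b" for b
    unfolding \<psi>_def using q_int[OF that]
    by (intro absolutely_integrable_continuous_mult continuous_intros)
  have \<psi>_int: "\<psi> integrable_on {0..b}" for b
  proof -
    have "\<psi> integrable_on {0..1}"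
      by (rule integrable_eq[of "\<lambda>_. 0"]) (auto simp: \<psi>_def)
    moreover have "\<psi> integrable_on {1..max 1 b}"
      using \<psi>_int1 set_lebesgue_integral_eq_integral(1) by (meson max.cobounded1)
    ultimately have "\<psi> integrable_on {0..max 1 b}"
      by (rule Henstock_Kurzweil_Integration.integrable_combine[rotated 2]) auto
    then show ?thesis by (rule integrable_on_subinterval) auto
  qed
  have P_cont: "continuous_on {0..b} P" for b
    unfolding P_def by (intro continuous_intros indefinite_integral_continuous_1 \<psi>_int)
  then have P_int: "P integrable_on {a..b}" if "0 \<le> a" for a b
    by (metis that atLeastatMost_subset_iff continuous_on_subset integrable_continuous_real order_refl)
  have P_mono: "P x \<le> P y" if "x \<le> y" for x y
    unfolding P_def using that \<psi>_int \<psi>_nonneg by (auto intro!: integral_subset_le)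
  have P_ge: "1 \<le> P x" for x
    unfolding P_def using \<psi>_nonneg by (auto intro!: integral_nonneg \<psi>_int)
  have P_unbounded: "\<exists>x>r. K < P x" for K r
  proof (rule ccontr)
    assume contr: "\<not> (\<exists>x>r. K < P x)"
    \<comment> \<open>Monotonicity carries the bound from arguments beyond \<open>r\<close> to all
      arguments.\<close>
    have P_le: "P x \<le> K" for x
      using contr P_mono[of x "max x (r + 1)"] by (smt (verit))
    have fi: "(\<lambda>x. x * q x) absolutely_integrable_on {1..b}" if "1 \<le> b" for b
      using q_int[OF that] by (intro absolutely_integrable_continuous_mult continuous_intros)
    have fi': "(\<lambda>x. x * q x) integrable_on {a..b}" if "1 \<le> a" for a b
    proof (cases "a \<le> b")
      case True
      then have "(\<lambda>x. x * q x) integrable_on {1..b}"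
        using fi[of b] that set_lebesgue_integral_eq_integral(1) by auto
      then show ?thesis by (rule integrable_on_subinterval) (use that in auto)
    qed auto
    have "(\<integral>\<^sup>+x\<in>{1..}. ennreal (x * q x) \<partial>lebesgue) < \<infinity>"
    proof (rule nn_integral_atLeast_bounded)
      \<comment> \<open>From 2 onwards \<open>x \<le> 2 * (x - 1)\<close>, so the integrand is
        dominated by \<open>\<psi>\<close>, whose integral is at most \<open>K\<close>. The piece
        over \<open>{1..2}\<close> is a fixed finite number.\<close>
      show "integral {1..b} (\<lambda>x. x * q x) \<le> integral {1..2} (\<lambda>x. x * q x) + K" if "1 \<le> b" for b
      proof -
        have "integral {1..b} (\<lambda>x. x * q x) \<le> integral {1..max 2 b} (\<lambda>x. x * q x)"
          using q by (intro integral_subset_le fi') auto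
        also have "\<dots> = integral {1..2} (\<lambda>x. x * q x) + integral {2..max 2 b} (\<lambda>x. x * q x)"
          by (intro Henstock_Kurzweil_Integration.integral_combine[symmetric] fi') auto
        also have "integral {2..max 2 b} (\<lambda>x. x * q x) \<le> integral {2..max 2 b} \<psi>"
        proof (rule integral_le)
          show "\<psi> integrable_on {2..max 2 b}"
            by (rule integrable_on_subinterval[OF \<psi>_int[of "max 2 b"]]) auto
          show "x * q x \<le> \<psi> x" if "x \<in> {2..max 2 b}" for x
            unfolding \<psi>_def using that q[of x] by (intro mult_right_mono) auto
        qed (intro fi', simp)
        also have "\<dots> \<le> integral {0..max 2 b} \<psi>"
          using \<psi>_nonneg by (intro integral_subset_le \<psi>_int integrable_on_subinterval[OF \<psi>_int[of "max 2 b"]]) auto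
        also have "\<dots> \<le> K" using P_le[of "max 2 b"] by (simp add: P_def)
        finally show ?thesis by simp
      qed
    qed (use fi q in auto)
    then show False using inf by simp
  qed
  have deriv_at: "((\<lambda>u. 1 + integral {0..u} f) has_real_derivative f x) (at x)"
    if "0 < x" "f integrable_on {0..x + 1}" "isCont f x" for f and x :: real
  proof -
    \<comment> \<open>The right end \<open>x + 1\<close> makes \<open>x\<close> an interior point,
      so the derivative within the interval is the ordinary one; the exceptional set is
      empty.\<close>
    have "((\<lambda>u. integral {0..u} f) has_vector_derivative f x) (at x within ({0..x + 1} - {}))"
      using that by (intro integral_has_vector_derivative_continuous_at)
        (auto intro: continuous_at_imp_continuous_at_within)
    moreover have "at x within ({0..x + 1} - {}) = at x"
      using that by (simp add: at_within_Icc_at)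
    ultimately have "((\<lambda>u. integral {0..u} f) has_real_derivative f x) (at x)"
      by (simp add: has_real_derivative_iff_has_vector_derivative)
    then show ?thesis by (auto intro!: derivative_eq_intros)
  qed
  show ?thesis
  proof (rule that[of \<phi> P])
    show "continuous_on {0..b} \<phi>" for b
      unfolding \<phi>_def using P_int[of 0] by (intro continuous_intros indefinite_integral_continuous_1) auto
    show "1 + x \<le> \<phi> x" if "0 \<le> x" for x
      using integral_le[of "\<lambda>_. 1" "{0..x}" P] P_int[of 0 x] P_ge that
      by (simp add: \<phi>_def integrable_const_ivl)
    show "(\<phi> has_real_derivative P x) (at x)" if "0 < x" for x
    proof -
      have "isCont P x"
        using continuous_on_interior[OF P_cont[of "x + 1"], of x] that by simp
      then show ?thesis unfolding \<phi>_def using P_int[of 0] that by (intro deriv_at) auto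
    qed
    show "(P has_real_derivative 2 * max 0 (x - 1) * q x) (at x)" if "0 < x" "isCont q x" for x
    proof -
      have "isCont \<psi> x"
        unfolding \<psi>_def by (intro continuous_intros that)
      then have "(P has_real_derivative \<psi> x) (at x)"
        unfolding P_def using \<psi>_int that by (intro deriv_at) auto
      then show ?thesis by (simp add: \<psi>_def)
    qed
    show "\<exists>R>r. C * (1 + R) < \<phi> R" for C r
    proof -
      \<comment> \<open>The witness is \<open>R = 2 * x\<close>. As \<open>P\<close> is increasing,
        its integral over \<open>{x..2 * x}\<close> is at least \<open>x * P x\<close>, and
        \<open>1 + 2 * x \<le> 4 * x\<close> explains the factor 4.\<close>
      obtain x where x: "max 1 \<bar>r\<bar> < x" "4 * \<bar>C\<bar> < P x"
        using P_unbounded by blast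
      have "4 * \<bar>C\<bar> * x \<le> P x * x"
        using x by (intro mult_right_mono) auto
      also have "\<dots> = integral {x..2 * x} (\<lambda>_. P x)"
        using x by simp
      also have "\<dots> \<le> integral {x..2 * x} P"
        using P_mono P_int x by (intro integral_le) auto
      also have "\<dots> \<le> integral {0..2 * x} P"
        using P_int x by (intro integral_subset_le) (auto intro: order_trans[OF _ P_ge])
      also have "\<dots> < \<phi> (2 * x)" by (simp add: \<phi>_def)
      finally have "4 * \<bar>C\<bar> * x < \<phi> (2 * x)" .
      moreover have "C * (1 + 2 * x) \<le> \<bar>C\<bar> * (4 * x)"
        using x by (intro mult_mono) auto
      ultimately show ?thesis using x by (intro exI[of _ "2 * x"]) auto
    qed
  qed
qed


section \<open>Regularity of the coefficient and the maximum principle\<close>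

lemma isCont_inverse_square_of_caloric:
  fixes \<sigma> a b :: "real \<Rightarrow> real"
  assumes "0 < x" and \<sigma>: "\<And>y. 0 < y \<Longrightarrow> \<sigma> y \<noteq> 0"
    and eq: "\<And>y. 0 < y \<Longrightarrow> a y + 1/2 * (\<sigma> y)\<^sup>2 * b y = 0"
    and "continuous_on {0<..} a" "continuous_on {0<..} b" and "b x \<noteq> 0"
  shows "isCont (\<lambda>y. 1 / (\<sigma> y)\<^sup>2) x"
proof -
  have cont: "isCont a x" "isCont b x"
    using assms(1,4,5) by (simp_all add: continuous_on_eq_continuous_at)
  have "a x \<noteq> 0"
    using eq[OF \<open>0 < x\<close>] \<sigma>[OF \<open>0 < x\<close>] \<open>b x \<noteq> 0\<close> by auto
  \<comment> \<open>The filter \<open>nhds x\<close> includes \<open>x\<close> itself. The identity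
    with the quotient \<open>- b y / (2 * a y)\<close> must hold there too, since continuity at
    \<open>x\<close> involves the value at \<open>x\<close>.\<close>
  have "(a \<longlongrightarrow> a x) (nhds x)"
    using cont(1) by (simp add: isCont_def tendsto_at_iff_tendsto_nhds)
  then have "\<forall>\<^sub>F y in nhds x. a y \<noteq> 0"
    using \<open>a x \<noteq> 0\<close> by (rule tendsto_imp_eventually_ne)
  moreover have "\<forall>\<^sub>F y in nhds x. y \<in> {0<..}"
    using \<open>0 < x\<close> by (intro eventually_nhds_in_open) auto
  ultimately have ev: "\<forall>\<^sub>F y in nhds x. 1 / (\<sigma> y)\<^sup>2 = - b y / (2 * a y)"
  proof eventually_elim
    case (elim y)
    then show ?case using eq[of y] \<sigma>[of y] by (simp add: field_simps)
  qed
  have "isCont (\<lambda>y. - b y / (2 * a y)) x"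
    using cont \<open>a x \<noteq> 0\<close> by (intro continuous_intros) auto
  then show ?thesis
    using isCont_cong[OF ev] by blast
qed

text \<open>The barrier \<open>\<epsilon> * e t * \<phi> x\<close> is a strict supersolution
  wherever the inverse square of \<open>\<sigma>\<close> is continuous: its time derivative
  contributes \<open>- \<phi> x\<close>, its diffusion term \<open>max 0 (x - 1)\<close>, both times
  \<open>\<epsilon> * e t\<close>, and \<open>\<phi> x \<ge> 1 + x\<close> dominates.\<close>

lemma homogeneous_solution_nonpos:
  fixes w wx wxx wt :: "real \<Rightarrow> real \<Rightarrow> real" and \<sigma> :: "real \<Rightarrow> real"
  assumes \<sigma>: "\<And>x. 0 < x \<Longrightarrow> \<sigma> x \<noteq> 0"
    and L1: "locally_L1_pos (\<lambda>x. 1 / (\<sigma> x)\<^sup>2)"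
    and inf: "(\<integral>\<^sup>+x\<in>{1..}. ennreal (x / (\<sigma> x)\<^sup>2) \<partial>lebesgue) = \<infinity>"
    and wx: "\<And>x t. 0 < x \<Longrightarrow> t \<in> {0..<T} \<Longrightarrow> ((\<lambda>y. w y t) has_real_derivative wx x t) (at x)"
    and wxx: "\<And>x t. 0 < x \<Longrightarrow> t \<in> {0..<T} \<Longrightarrow> ((\<lambda>y. wx y t) has_real_derivative wxx x t) (at x)"
    and wt: "\<And>x t. 0 < x \<Longrightarrow> t \<in> {0..<T} \<Longrightarrow> ((\<lambda>s. w x s) has_real_derivative wt x t) (at t within {0..<T})"
    and wxx_cont: "\<And>t. t \<in> {0..<T} \<Longrightarrow> continuous_on {0<..} (\<lambda>x. wxx x t)"
    and wt_cont: "\<And>t. t \<in> {0..<T} \<Longrightarrow> continuous_on {0<..} (\<lambda>x. wt x t)"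
    and cont: "continuous_on ({0..} \<times> {0..T}) (\<lambda>(x, t). w x t)"
    and eq: "\<And>x t. 0 < x \<Longrightarrow> t \<in> {0..<T} \<Longrightarrow> wt x t + 1/2 * (\<sigma> x)\<^sup>2 * wxx x t = 0"
    and bdry: "\<And>t. t \<in> {0..T} \<Longrightarrow> w 0 t = 0" and final: "\<And>x. 0 \<le> x \<Longrightarrow> w x T = 0"
    and growth: "\<And>x t. 0 \<le> x \<Longrightarrow> t \<in> {0..T} \<Longrightarrow> w x t \<le> C * (1 + x)"
    and "0 \<le> x1" "t1 \<in> {0..T}"
  shows "w x1 t1 \<le> 0"
proof -
  have "0 \<le> 1 / (\<sigma> x)\<^sup>2" for x by simp
  moreover have "(\<integral>\<^sup>+x\<in>{1..}. ennreal (x * (1 / (\<sigma> x)\<^sup>2)) \<partial>lebesgue) = \<infinity>"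
    using inf by simp
  ultimately obtain \<phi> P where
    \<phi>_cont: "\<And>b. continuous_on {0..b} \<phi>" and \<phi>_ge: "\<And>x. 0 \<le> x \<Longrightarrow> 1 + x \<le> \<phi> x"
    and \<phi>': "\<And>x. 0 < x \<Longrightarrow> (\<phi> has_real_derivative P x) (at x)"
    and P': "\<And>x. 0 < x \<Longrightarrow> isCont (\<lambda>x. 1 / (\<sigma> x)\<^sup>2) x \<Longrightarrow>
      (P has_real_derivative 2 * max 0 (x - 1) * (1 / (\<sigma> x)\<^sup>2)) (at x)"
    and \<phi>_superlinear: "\<And>C r. \<exists>R>r. C * (1 + R) < \<phi> R"
    using superlinear_comparison_function[OF L1] by blast
  define e where "e t = exp (T - t)" for t :: real
  have e_ge: "1 \<le> e t" if "t \<in> {0..T}" for t using that by (simp add: e_def)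
  have main: "w x1 t1 \<le> \<epsilon> * e t1 * \<phi> x1" if "0 < \<epsilon>" for \<epsilon>
  proof (rule ccontr)
    assume neg: "\<not> w x1 t1 \<le> \<epsilon> * e t1 * \<phi> x1"
    define z where "z x t = w x t - \<epsilon> * e t * \<phi> x" for x t
    \<comment> \<open>The box must contain the violating point, and at its right edge the barrier
      must exceed the linear growth bound, so that no positive maximum of \<open>z\<close> lies
      there.\<close>
    obtain R where R: "x1 < R" "C / \<epsilon> * (1 + R) < \<phi> R" using \<phi>_superlinear by blast
    have compact: "compact ({0..R} \<times> {0..T})" by (intro compact_Times) auto
    have nonempty: "{0..R} \<times> {0..T} \<noteq> {}" using \<open>0 \<le> x1\<close> R \<open>t1 \<in> {0..T}\<close> by auto
    have "continuous_on ({0..R} \<times> {0..T}) (\<lambda>p. z (fst p) (snd p))"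
    proof -
      have "continuous_on ({0..R} \<times> {0..T}) (\<lambda>p. \<phi> (fst p))"
        by (rule continuous_on_compose2[OF \<phi>_cont[of R]]) (auto intro: continuous_intros)
      moreover have "continuous_on ({0..R} \<times> {0..T}) (\<lambda>p. w (fst p) (snd p))"
        using continuous_on_subset[OF cont, of "{0..R} \<times> {0..T}"] by (simp add: case_prod_beta Sigma_mono)
      ultimately show ?thesis
        unfolding z_def e_def by (intro continuous_intros)
    qed
    then obtain p where p: "p \<in> {0..R} \<times> {0..T}"
      "\<And>y. y \<in> {0..R} \<times> {0..T} \<Longrightarrow> z (fst y) (snd y) \<le> z (fst p) (snd p)"
      using continuous_attains_sup[OF compact nonempty] by blast
    obtain x0 t0 where p_eq: "p = (x0, t0)" by (cases p)
    have x0: "x0 \<in> {0..R}" and t0: "t0 \<in> {0..T}" using p p_eq by auto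
    have max: "z x t \<le> z x0 t0" if "x \<in> {0..R}" "t \<in> {0..T}" for x t
      using p(2)[of "(x, t)"] that p_eq by simp
    have "0 < z x0 t0"
      using max[of x1 t1] neg R \<open>0 \<le> x1\<close> \<open>t1 \<in> {0..T}\<close> by (simp add: z_def)
    moreover have "0 < \<phi> x0" using \<phi>_ge[of x0] x0 by simp
    then have "0 < \<epsilon> * e t0 * \<phi> x0" using \<open>0 < \<epsilon>\<close> by (simp add: e_def)
    ultimately have "0 < w x0 t0" by (simp add: z_def)
    then have "x0 \<noteq> 0" "t0 \<noteq> T" using bdry final x0 t0 by force+
    have "x0 \<noteq> R"
    proof
      assume "x0 = R"
      have "C * (1 + R) < \<epsilon> * \<phi> R" using R \<open>0 < \<epsilon>\<close> by (simp add: field_simps)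
      also have "\<dots> \<le> \<epsilon> * e t0 * \<phi> R"
        using e_ge[OF t0] \<open>0 < \<epsilon>\<close> \<open>0 < \<phi> x0\<close> \<open>x0 = R\<close> by simp
      also have "\<dots> < w R t0" using \<open>0 < z x0 t0\<close> \<open>x0 = R\<close> by (simp add: z_def)
      finally show False using growth[of R t0] x0 t0 \<open>x0 = R\<close> by simp
    qed
    have x0': "0 < x0" "x0 < R" and t0': "t0 \<in> {0..<T}"
      using \<open>x0 \<noteq> 0\<close> \<open>x0 \<noteq> R\<close> \<open>t0 \<noteq> T\<close> x0 t0 by auto
    have "\<exists>s\<in>{0..<T}. wxx x0 s \<noteq> 0"
    proof (rule ccontr)
      assume "\<not> (\<exists>s\<in>{0..<T}. wxx x0 s \<noteq> 0)"
      then have "wt x0 s = 0" if "s \<in> {0..<T}" for s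
        using eq[OF x0'(1) that] that by auto
      then have "((\<lambda>s. w x0 s) has_field_derivative 0) (at s within {0..<T})" if "s \<in> {0..<T}" for s
        using wt[OF x0'(1) that] that by simp
      then obtain c where c: "\<forall>s\<in>{0..<T}. w x0 s = c"
        using has_field_derivative_zero_constant[of "{0..<T}" "\<lambda>s. w x0 s"] by auto
      \<comment> \<open>The equation makes \<open>w x0\<close> constant only before time
        \<open>T\<close>. Continuity up to \<open>T\<close> is what ties this constant to the zero
        terminal value.\<close>
      have "continuous_on {t0..T} (\<lambda>s. w (fst (x0, s)) (snd (x0, s)))"
        by (rule continuous_on_compose2[OF cont[unfolded case_prod_beta]])
          (use x0 t0 in \<open>auto intro!: continuous_intros\<close>)
      moreover have "closure {t0..<T} = {t0..T}"
        using t0' by (simp add: closure_atLeastLessThan)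
      moreover have "w x0 s = c" if "s \<in> {t0..<T}" for s
        using c t0' that by auto
      ultimately have "w x0 T = c"
        using continuous_constant_on_closure[of "{t0..<T}" "\<lambda>s. w x0 s" c T] t0' by simp
      then show False using c t0' final[of x0] x0 \<open>0 < w x0 t0\<close> by auto
    qed
    \<comment> \<open>The time \<open>s\<close> may differ from \<open>t0\<close>:
      \<open>\<sigma>\<close> does not depend on time, so any one slice decides its continuity at
      \<open>x0\<close>.\<close>
    then obtain s where s: "s \<in> {0..<T}" "wxx x0 s \<noteq> 0" by blast
    have "isCont (\<lambda>x. 1 / (\<sigma> x)\<^sup>2) x0"
      using isCont_inverse_square_of_caloric[of x0 \<sigma> "\<lambda>x. wt x s" "\<lambda>x. wxx x s"]
        x0' \<sigma> eq s wt_cont wxx_cont by blast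
    then have P'x0: "(P has_real_derivative 2 * max 0 (x0 - 1) * (1 / (\<sigma> x0)\<^sup>2)) (at x0)"
      using P' x0' by blast
    \<comment> \<open>This is the second space derivative of \<open>z\<close> at the maximum
      point.\<close>
    define D where "D = wxx x0 t0 - \<epsilon> * e t0 * (2 * max 0 (x0 - 1) * (1 / (\<sigma> x0)\<^sup>2))"
    have "D \<le> 0"
    proof (rule second_derivative_nonpos_at_local_max)
      define d where "d = min x0 (R - x0)"
      show "0 < d" using x0' by (simp add: d_def)
      show "((\<lambda>y. z y t0) has_real_derivative (wx y t0 - \<epsilon> * e t0 * P y)) (at y)" if "\<bar>y - x0\<bar> < d" for y
      proof -
        have "0 < y" using that by (auto simp: d_def)
        then show ?thesis unfolding z_def by (intro DERIV_diff DERIV_cmult wx \<phi>' t0')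
      qed
      show "((\<lambda>y. wx y t0 - \<epsilon> * e t0 * P y) has_real_derivative D) (at x0)"
        unfolding D_def by (intro DERIV_diff DERIV_cmult wxx P'x0 x0' t0')
      show "z y t0 \<le> z x0 t0" if "\<bar>y - x0\<bar> < d" for y
        using that by (intro max t0) (auto simp: d_def)
    qed
    \<comment> \<open>The left side is the time derivative of \<open>z\<close>; the sign is positive
      because \<open>e\<close> is its own negative derivative.\<close>
    have "wt x0 t0 + \<epsilon> * e t0 * \<phi> x0 \<le> 0"
    proof (rule derivative_nonpos_at_right_max[where f = "\<lambda>s. z x0 s"])
      show "((\<lambda>s. z x0 s) has_real_derivative wt x0 t0 + \<epsilon> * e t0 * \<phi> x0) (at t0 within {0..<T})"
        unfolding z_def e_def by (rule derivative_eq_intros wt x0' t0' refl | simp)+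
      show "z x0 s \<le> z x0 t0" if "s \<in> {0..<T}" for s
        using that by (intro max x0) auto
    qed (use t0' in auto)
    moreover have "1/2 * (\<sigma> x0)\<^sup>2 * D \<le> 0"
      using \<open>D \<le> 0\<close> by (simp add: mult_nonneg_nonpos)
    moreover have "1/2 * (\<sigma> x0)\<^sup>2 * D = 1/2 * (\<sigma> x0)\<^sup>2 * wxx x0 t0 - \<epsilon> * e t0 * max 0 (x0 - 1)"
      unfolding D_def using \<sigma>[OF x0'(1)] by (simp add: field_simps)
    \<comment> \<open>Adding the two derivative inequalities, the equation cancels all terms in
      \<open>w\<close>. Only the barrier remains, and it violates its own strict inequality.\<close>
    ultimately have "\<epsilon> * e t0 * \<phi> x0 \<le> \<epsilon> * e t0 * max 0 (x0 - 1)"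
      using eq[OF x0'(1) t0'] by linarith
    then have "\<phi> x0 \<le> max 0 (x0 - 1)"
      using \<open>0 < \<epsilon>\<close> by (simp add: e_def)
    then show False using \<phi>_ge[of x0] x0 by auto
  qed
  \<comment> \<open>The box and the maximum point depend on \<open>\<epsilon>\<close>, but the
    resulting bound is at the fixed point \<open>(x1, t1)\<close>, so \<open>\<epsilon>\<close> may
    tend to 0.\<close>
  have "((\<lambda>\<epsilon>. \<epsilon> * e t1 * \<phi> x1) \<longlongrightarrow> 0 * e t1 * \<phi> x1) (at_right 0)"
    by (intro tendsto_intros)
  moreover have "\<forall>\<^sub>F \<epsilon> in at_right 0. w x1 t1 \<le> \<epsilon> * e t1 * \<phi> x1"
    using eventually_at_right_less by (rule eventually_mono) (rule main)
  ultimately show ?thesis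
    using tendsto_lowerbound[of "\<lambda>\<epsilon>. \<epsilon> * e t1 * \<phi> x1" 0 "at_right 0" "w x1 t1"] by simp
qed

section \<open>Comparison of two classical solutions\<close>

lemma C21_derivatives:
  assumes "C21 T u" "0 < x" "t \<in> {0..<T}"
  shows "((\<lambda>y. u y t) has_real_derivative dx u x t) (at x)"
    and "((\<lambda>y. dx u y t) has_real_derivative dxx u x t) (at x)"
    and "((\<lambda>s. u x s) has_real_derivative dt T u x t) (at t within {0..<T})"
proof -
  have d: "(\<lambda>y. u y t) differentiable (at x)" "(\<lambda>y. dx u y t) differentiable (at x)"
    "(\<lambda>s. u x s) differentiable (at t within {0..<T})"
    using assms by (auto simp: C21_def)
  show "((\<lambda>y. u y t) has_real_derivative dx u x t) (at x)"
    "((\<lambda>y. dx u y t) has_real_derivative dxx u x t) (at x)"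
    using d by (auto simp: dxx_def dx_def DERIV_deriv_iff_real_differentiable)
  show "((\<lambda>s. u x s) has_real_derivative dt T u x t) (at t within {0..<T})"
    using d assms(3) unfolding dt_def has_real_derivative_iff_has_vector_derivative
    by (simp add: vector_derivative_works)
qed

lemma C21_continuous:
  assumes "C21 T u" "t \<in> {0..<T}"
  shows "continuous_on {0<..} (\<lambda>x. dxx u x t)" "continuous_on {0<..} (\<lambda>x. dt T u x t)"
proof -
  have c: "continuous_on ({0<..} \<times> {0..<T}) (\<lambda>(x, t). dxx u x t)"
    "continuous_on ({0<..} \<times> {0..<T}) (\<lambda>(x, t). dt T u x t)"
    using assms by (auto simp: C21_def)
  have slice: "continuous_on {0<..} (\<lambda>x. (x, t))" "(\<lambda>x. (x, t)) ` {0<..} \<subseteq> {0<..} \<times> {0..<T}"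
    using assms by (auto intro: continuous_intros)
  show "continuous_on {0<..} (\<lambda>x. dxx u x t)" "continuous_on {0<..} (\<lambda>x. dt T u x t)"
    using continuous_on_compose2[OF c(1) slice] continuous_on_compose2[OF c(2) slice] by simp_all
qed

text \<open>By linearity the difference solves the same equation; the common data cancel and the
  growth constants add. The hypotheses are symmetric in \<open>u\<close> and \<open>v\<close>, so
  exchanging them turns this inequality into uniqueness.\<close>

lemma classical_solutions_le:
  fixes \<sigma> :: "real \<Rightarrow> real"
  assumes \<sigma>: "\<forall>x>0. \<sigma> x \<noteq> 0"
    and L1: "locally_L1_pos (\<lambda>x. 1 / (\<sigma> x)\<^sup>2)"
    and inf: "(\<integral>\<^sup>+x\<in>{1..}. ennreal (x / (\<sigma> x)\<^sup>2) \<partial>lebesgue) = \<infinity>"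
    and u: "classical_solution T \<sigma> g u" "linear_growth T u"
    and v: "classical_solution T \<sigma> g v" "linear_growth T v"
    and x1: "0 \<le> x1" and t1: "t1 \<in> {0..T}"
  shows "u x1 t1 \<le> v x1 t1"
proof -
  have C21: "C21 T u" "C21 T v"
    using u v by (auto simp: classical_solution_def)
  obtain A B where A: "\<forall>x\<ge>0. \<forall>t\<in>{0..T}. \<bar>u x t\<bar> \<le> A * (1 + x)"
    and B: "\<forall>x\<ge>0. \<forall>t\<in>{0..T}. \<bar>v x t\<bar> \<le> B * (1 + x)"
    using u v by (auto simp: linear_growth_def)
  have "u x1 t1 - v x1 t1 \<le> 0"
  proof (rule homogeneous_solution_nonpos[OF _ L1 inf, where T = T and w = "\<lambda>x t. u x t - v x t"])
    show "((\<lambda>y. u y t - v y t) has_real_derivative dx u x t - dx v x t) (at x)"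
      "((\<lambda>y. dx u y t - dx v y t) has_real_derivative dxx u x t - dxx v x t) (at x)"
      "((\<lambda>s. u x s - v x s) has_real_derivative dt T u x t - dt T v x t) (at t within {0..<T})"
      if "0 < x" "t \<in> {0..<T}" for x t
      using that by (auto intro!: DERIV_diff C21_derivatives C21)
    show "continuous_on {0<..} (\<lambda>x. dxx u x t - dxx v x t)"
      "continuous_on {0<..} (\<lambda>x. dt T u x t - dt T v x t)" if "t \<in> {0..<T}" for t
      using that by (auto intro!: continuous_on_diff C21_continuous C21)
    show "continuous_on ({0..} \<times> {0..T}) (\<lambda>(x, t). u x t - v x t)"
      using u(1) v(1) by (auto simp: classical_solution_def case_prod_beta intro: continuous_on_diff)
    show "dt T u x t - dt T v x t + 1/2 * (\<sigma> x)\<^sup>2 * (dxx u x t - dxx v x t) = 0"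
      if "0 < x" "t \<in> {0..<T}" for x t
    proof -
      have "dt T u x t + 1/2 * (\<sigma> x)\<^sup>2 * dxx u x t = 0" "dt T v x t + 1/2 * (\<sigma> x)\<^sup>2 * dxx v x t = 0"
        using u v that by (auto simp: classical_solution_def)
      then show ?thesis unfolding right_diff_distrib by linarith
    qed
    show "u x t - v x t \<le> (A + B) * (1 + x)" if "0 \<le> x" "t \<in> {0..T}" for x t
    proof -
      have "\<bar>u x t\<bar> \<le> A * (1 + x)" "\<bar>v x t\<bar> \<le> B * (1 + x)"
        using A B that by blast+
      then show ?thesis unfolding distrib_right by linarith
    qed
  qed (use \<sigma> u v x1 t1 in \<open>auto simp: classical_solution_def\<close>)
  then show ?thesis by simp
qed

theorem theorem1:
  fixes T :: real and \<sigma> g :: "real \<Rightarrow> real"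
  assumes "T > 0"
    and "\<forall>x>0. \<sigma> x \<noteq> 0"
    and "\<forall>x\<le>0. \<sigma> x = 0"
    and "locally_L1_pos (\<lambda>x. 1 / (\<sigma> x)\<^sup>2)"
    and "\<forall>x\<ge>0. g x \<ge> 0"
    and "\<exists>C>0. \<forall>x\<ge>0. g x \<le> C * (1 + x)"
    and "(\<integral>\<^sup>+x\<in>{1..}. ennreal (x / (\<sigma> x)\<^sup>2) \<partial>lebesgue) = \<infinity>"
  shows "\<forall>u v. classical_solution T \<sigma> g u \<and> linear_growth T u \<and>
               classical_solution T \<sigma> g v \<and> linear_growth T v \<longrightarrow>
               (\<forall>x\<ge>0. \<forall>t\<in>{0..T}. u x t = v x t)"
  using classical_solutions_le[OF assms(2,4,7)] by (meson order_antisym)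

end
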